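(* Let $\varphi:\mathbb{N}\to(0,+\infty)$ be a monotonically increasing function with $\lim_{n\to\infty}\varphi(n)=+\infty$ and $\limsup_{n\to\infty}\frac{n}{\varphi(n)}=+\infty$. Let \[ E_{\max}^\varphi=\left\{x\in [0,1]:\liminf_{n\to\infty}\frac{r_n(x)}{\varphi(n)}=0,\ \limsup_{n\to\infty}\frac{r_n(x)}{\varphi(n)}=+\infty\right\}, \] where $r_n(x)$ is the run-length function of $x$. Then the set $E_{\max}^\varphi$ is residual in $[0,1]$.
   Context: $\mathbb{N}=\{1,2,3,\ldots\}$. Every $x\in[0,1]$ admits a dyadic expansion $x=\sum_{k=1}^\infty x_k 2^{-k}$ with $x_k\in\{0,1\}$ for all $k\ge1$; the sequence $(x_1,x_2,\ldots)$ is called the digit sequence of $x$. (For the countably many $x$ having two dyadic expansions, one of them is fixed, arbitrarily, as the digit sequence of $x$.) For $n\ge1$ and $x\in[0,1]$, the run-length function $r_n(x)$ is the length of the longest run of $1$'s among the first $n$ digits $(x_1,\ldots,x_n)$: \[ r_n(x)=\max\{\ell\ge 0:\ x_{i+1}=\cdots=x_{i+\ell}=1\ \text{for some } 0\le i\le n-\ell\}, \] so $r_n(x)=0$ if $x_1=\cdots=x_n=0$. A subset $R$ of a metric space $X$ is called residual if its complement $X\setminus R$ is of the first category (a countable union of nowhere dense sets); here $X=[0,1]$ with the usual metric. *)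

theory Defs
  imports "HOL-Analysis.Analysis"
begin

(* Binary expansions of the points of [0,1]: d x k is the k-th digit of x, k = 1, 2, ...
   The value d x 0 is unused.  A point with two expansions may be assigned either of them,
   so any map satisfying this predicate is an admissible choice of digit sequences. *)
definition dyadic_digits :: "(real \<Rightarrow> nat \<Rightarrow> nat) \<Rightarrow> bool" where
  "dyadic_digits d \<longleftrightarrow>
     (\<forall>x\<in>{0..1}. (\<forall>k\<ge>1. d x k \<in> {0, 1}) \<and>
        (\<lambda>k. real (d x (Suc k)) / 2 ^ Suc k) sums x)"

(* The condition i + l \<le> n says l \<le> n and i \<le> n - l without truncated subtraction. *)
definition run_length :: "(nat \<Rightarrow> nat) \<Rightarrow> nat \<Rightarrow> nat" where
  "run_length s n = Max {l. \<exists>i. i + l \<le> n \<and> (\<forall>j\<in>{i+1..i+l}. s j = 1)}"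

definition E_max :: "(real \<Rightarrow> nat \<Rightarrow> nat) \<Rightarrow> (nat \<Rightarrow> real) \<Rightarrow> real set" where
  "E_max d \<phi> = {x\<in>{0..1}.
     liminf (\<lambda>n. ereal (real (run_length (d x) n) / \<phi> n)) = 0 \<and>
     limsup (\<lambda>n. ereal (real (run_length (d x) n) / \<phi> n)) = \<infinity>}"

definition nowhere_dense_in :: "'a topology \<Rightarrow> 'a set \<Rightarrow> bool" where
  "nowhere_dense_in X A \<longleftrightarrow>
     A \<subseteq> topspace X \<and> X interior_of (X closure_of A) = {}"

definition first_category_in :: "'a topology \<Rightarrow> 'a set \<Rightarrow> bool" where
  "first_category_in X A \<longleftrightarrow>
     (\<exists>F. countable F \<and> (\<forall>N\<in>F. nowhere_dense_in X N) \<and> A = \<Union>F)"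

definition residual_in :: "'a topology \<Rightarrow> 'a set \<Rightarrow> bool" where
  "residual_in X R \<longleftrightarrow> R \<subseteq> topspace X \<and> first_category_in X (topspace X - R)"

end

theory Submission
  imports Defs
begin

text \<open>
  Membership in the set is governed by the events that the ratio of the run length to \<open>\<phi>\<close> is
  below \<open>1 / (m + 1)\<close> at some late time, and that it is above \<open>m\<close> at some late time, for every
  \<open>m\<close>. Each of these events contains a dense open set, because it can be forced by a suitable
  choice of finitely many further digits after an arbitrary prefix of length \<open>N\<close>:

  \<^item> a long block of zeros up to position \<open>n\<close> keeps the run length at most \<open>N\<close>, whereas \<open>\<phi> n\<close>
    tends to infinity;
  \<^item> a block of ones up to position \<open>n \<ge> 2 * N\<close> makes the run length at least \<open>n / 2\<close>, and
    \<open>n / \<phi> n\<close> is unbounded.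

  Prefixes correspond to dyadic intervals. On the \<^emph>\<open>open\<close> dyadic intervals of level \<open>k\<close> the digit at
  position \<open>k\<close> does not depend on the choice of the expansion (lemma \<open>digit_eq_parity\<close>); a block of
  zeros is forced near the left end of such an interval and a block of ones near its right end.
  So the failure set of each event misses an open subinterval of every interval, hence is
  nowhere dense, and countably many such sets cover the complement.
\<close>

section \<open>Digits on open dyadic intervals\<close>

text \<open>The integer whose binary notation is \<open>s 1, ..., s k\<close>.\<close>

primrec binary_prefix :: "(nat \<Rightarrow> nat) \<Rightarrow> nat \<Rightarrow> nat" where
  "binary_prefix s 0 = 0"
| "binary_prefix s (Suc k) = 2 * binary_prefix s k + s (Suc k)"

lemma sum_digits_eq_binary_prefix:
  "(\<Sum>i<k. real (s (Suc i)) / 2 ^ Suc i) = real (binary_prefix s k) / 2 ^ k"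
  by (induction k) (auto simp: field_simps)

lemma binary_prefix_bounds:
  assumes dig: "\<And>k. k \<ge> 1 \<Longrightarrow> s k \<in> {0, 1}"
    and sums: "(\<lambda>k. real (s (Suc k)) / 2 ^ Suc k) sums x"
  shows "real (binary_prefix s k) \<le> x * 2 ^ k" "x * 2 ^ k \<le> real (binary_prefix s k) + 1"
proof -
  define p where "p = (\<lambda>k. real (binary_prefix s k) / 2 ^ k)"
  have lim: "p \<longlonglongrightarrow> x"
    using sums unfolding sums_def sum_digits_eq_binary_prefix p_def .
  have "incseq p"
    by (rule incseq_SucI) (simp add: p_def field_simps)
  then have "p k \<le> x"
    using lim by (rule incseq_le)
  then show "real (binary_prefix s k) \<le> x * 2 ^ k"
    by (simp add: p_def field_simps)
  have "(\<lambda>k. p k + (1/2) ^ k) \<longlonglongrightarrow> x + 0"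
    by (intro tendsto_add lim LIMSEQ_realpow_zero) auto
  moreover have "decseq (\<lambda>k. p k + (1/2) ^ k)"
  proof (rule decseq_SucI)
    fix n
    have "s (Suc n) \<le> 1"
      using dig[of "Suc n"] by auto
    then show "p (Suc n) + (1/2) ^ Suc n \<le> p n + (1/2) ^ n"
      by (simp add: p_def field_simps)
  qed
  ultimately have "x \<le> p k + (1/2) ^ k"
    using decseq_ge[of "\<lambda>k. p k + (1/2) ^ k" x k] by simp
  then show "x * 2 ^ k \<le> real (binary_prefix s k) + 1"
    by (simp add: p_def field_simps)
qed

text \<open>
  The strict inequalities exclude the two endpoints, where another expansion could have a
  different digit; inside the interval the first \<open>k\<close> digits must be the binary notation of \<open>j\<close>.
\<close>

lemma digit_eq_parity:
  assumes dig: "\<And>k. k \<ge> 1 \<Longrightarrow> s k \<in> {0, 1}"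
    and sums: "(\<lambda>k. real (s (Suc k)) / 2 ^ Suc k) sums x"
    and x: "real j < x * 2 ^ k" "x * 2 ^ k < real j + 1"
    and k: "k \<ge> 1"
  shows "s k = j mod 2"
proof -
  have "binary_prefix s k = j"
    using binary_prefix_bounds[OF dig sums, of k] x by linarith
  moreover obtain k' where "k = Suc k'"
    using k by (cases k) auto
  moreover have "s k \<in> {0, 1}"
    using dig k by blast
  ultimately show ?thesis
    by auto
qed

text \<open>
  For every \<open>k\<close> between \<open>N\<close> and \<open>n\<close>, an interval of length \<open>1 / 2 ^ n\<close> adjacent to the left end of
  a dyadic interval of level \<open>N\<close> lies in the first of the \<open>2 ^ (k - N)\<close> subintervals of level \<open>k\<close>,
  whose index is a multiple of \<open>2 ^ (k - N)\<close> and so even. At the right end it lies in the last of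
  them, with an index one below such a multiple.
\<close>

lemma digits_zero_at_left_end:
  assumes dig: "\<And>k. k \<ge> 1 \<Longrightarrow> s k \<in> {0, 1}"
    and sums: "(\<lambda>k. real (s (Suc k)) / 2 ^ Suc k) sums x"
    and x: "real j / 2 ^ N < x" "x < real j / 2 ^ N + 1 / 2 ^ n"
    and k: "N < k" "k \<le> n"
  shows "s k = 0"
proof -
  have scale: "(2::real) ^ k = 2 ^ N * 2 ^ (k - N)"
    using k by (simp flip: power_add)
  have "(1::real) / 2 ^ n \<le> 1 / 2 ^ k"
    using k by (intro divide_left_mono power_increasing) auto
  then have "x < real j / 2 ^ N + 1 / 2 ^ k"
    using x by linarith
  then have "x * 2 ^ k < (real j / 2 ^ N + 1 / 2 ^ k) * 2 ^ k"
    by (intro mult_strict_right_mono) auto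
  also have "\<dots> = real (j * 2 ^ (k - N)) + 1"
    by (simp add: distrib_right) (simp add: scale)
  finally have upper: "x * 2 ^ k < real (j * 2 ^ (k - N)) + 1" .
  have "(real j / 2 ^ N) * 2 ^ k < x * 2 ^ k"
    using x by (intro mult_strict_right_mono) auto
  then have lower: "real (j * 2 ^ (k - N)) < x * 2 ^ k"
    by (simp add: scale)
  have "s k = (j * 2 ^ (k - N)) mod 2"
    using k by (intro digit_eq_parity[OF dig sums lower upper]) auto
  then show ?thesis
    using k by simp
qed

lemma digits_one_at_right_end:
  assumes dig: "\<And>k. k \<ge> 1 \<Longrightarrow> s k \<in> {0, 1}"
    and sums: "(\<lambda>k. real (s (Suc k)) / 2 ^ Suc k) sums x"
    and x: "real (Suc j) / 2 ^ N - 1 / 2 ^ n < x" "x < real (Suc j) / 2 ^ N"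
    and k: "N < k" "k \<le> n"
  shows "s k = 1"
proof -
  define q where "q = Suc j * 2 ^ (k - N)"
  have q: "q \<ge> 1" "even q"
    using k by (simp_all add: q_def del: mult_Suc)
  have scale: "(2::real) ^ k = 2 ^ N * 2 ^ (k - N)"
    using k by (simp flip: power_add)
  have q_eq: "real (Suc j) / 2 ^ N * 2 ^ k = real q"
    by (simp add: scale q_def field_simps)
  have "(1::real) / 2 ^ n \<le> 1 / 2 ^ k"
    using k by (intro divide_left_mono power_increasing) auto
  then have "real (Suc j) / 2 ^ N - 1 / 2 ^ k < x"
    using x by linarith
  then have "(real (Suc j) / 2 ^ N - 1 / 2 ^ k) * 2 ^ k < x * 2 ^ k"
    by (intro mult_strict_right_mono) auto
  then have "real q - 1 < x * 2 ^ k"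
    unfolding left_diff_distrib q_eq by simp
  then have lower: "real (q - 1) < x * 2 ^ k"
    using q by (simp add: of_nat_diff)
  have "x * 2 ^ k < real (Suc j) / 2 ^ N * 2 ^ k"
    using x by (intro mult_strict_right_mono) auto
  then have upper: "x * 2 ^ k < real (q - 1) + 1"
    using q unfolding q_eq by (simp add: of_nat_diff)
  have "s k = (q - 1) mod 2"
    using k by (intro digit_eq_parity[OF dig sums lower upper]) auto
  also have "odd (q - 1)"
    using q by simp
  then have "(q - 1) mod 2 = 1"
    by (simp only: odd_iff_mod_2_eq_one)
  finally show ?thesis .
qed

section \<open>Blocks of equal digits and run lengths\<close>

lemma finite_run_lengths:
  fixes n :: nat
  shows "finite {l. \<exists>i. i + l \<le> n \<and> (\<forall>j\<in>{i+1..i+l}. s j = (1::nat))}"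
  by (rule finite_subset[OF _ finite_atMost[of n]]) auto

text \<open>A run longer than \<open>N\<close> has its last digit in the block of zeros.\<close>

lemma run_length_le_if_zeros:
  assumes "\<And>k. N < k \<Longrightarrow> k \<le> n \<Longrightarrow> s k = 0"
  shows "run_length s n \<le> N"
  unfolding run_length_def
proof (intro Max.boundedI finite_run_lengths)
  show "{l. \<exists>i. i + l \<le> n \<and> (\<forall>j\<in>{i+1..i+l}. s j = 1)} \<noteq> {}"
    by (auto intro!: exI[of _ 0])
next
  fix l assume "l \<in> {l. \<exists>i. i + l \<le> n \<and> (\<forall>j\<in>{i+1..i+l}. s j = 1)}"
  then obtain i where i: "i + l \<le> n" "\<forall>j\<in>{i+1..i+l}. s j = 1"
    by blast
  show "l \<le> N"
  proof (rule ccontr)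
    assume "\<not> l \<le> N"
    then have "s (i + l) = 1" "s (i + l) = 0"
      using i assms[of "i + l"] by auto
    then show False
      by simp
  qed
qed

lemma run_length_ge_if_ones:
  assumes "\<And>k. N < k \<Longrightarrow> k \<le> n \<Longrightarrow> s k = 1" and "N \<le> n"
  shows "n - N \<le> run_length s n"
  unfolding run_length_def
  using assms by (intro Max_ge finite_run_lengths) (auto intro!: exI[of _ N])

section \<open>Nowhere dense subsets of the unit interval\<close>

text \<open>An open interval disjoint from a set is disjoint from its closure too.\<close>

lemma nowhere_dense_in_unit_intervalI:
  fixes A :: "real set"
  assumes A: "A \<subseteq> {0..1}"
    and gap: "\<And>a b. 0 \<le> a \<Longrightarrow> a < b \<Longrightarrow> b \<le> 1 \<Longrightarrow>
      \<exists>u v. a \<le> u \<and> u < v \<and> v \<le> b \<and> {u<..<v} \<inter> A = {}"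
  shows "nowhere_dense_in (top_of_set {0..1}) A"
proof -
  let ?X = "top_of_set {0..1::real}"
  have "x \<notin> ?X interior_of (?X closure_of A)" for x
  proof
    assume "x \<in> ?X interior_of (?X closure_of A)"
    then obtain T where T: "open T" "x \<in> T" "x \<in> {0..1}" "{0..1} \<inter> T \<subseteq> ?X closure_of A"
      by (auto simp: interior_of_def openin_open)
    obtain e where e: "e > 0" "ball x e \<subseteq> T"
      using T openE by blast
    define a b where "a = max 0 (x - e)" and "b = min 1 (x + e)"
    have ab: "0 \<le> a" "a < b" "b \<le> 1"
      using T(3) e by (auto simp: a_def b_def)
    have "{a<..<b} \<subseteq> {0..1} \<inter> T"
      using e(2) by (force simp: a_def b_def dist_real_def subset_iff)
    moreover have "?X closure_of A \<subseteq> closure A"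
      using A by (auto simp: closure_of_subtopology Int_absorb1)
    ultimately have dense: "{a<..<b} \<subseteq> closure A"
      using T(4) by blast
    obtain u v where uv: "a \<le> u" "u < v" "v \<le> b" "{u<..<v} \<inter> A = {}"
      using gap[OF ab] by blast
    then have "{u<..<v} \<inter> closure A = {}"
      using open_Int_closure_eq_empty[of "{u<..<v}" A] by simp
    moreover have "(u + v) / 2 \<in> {u<..<v}" "{u<..<v} \<subseteq> {a<..<b}"
      using uv by auto
    ultimately show False
      using dense by blast
  qed
  then show ?thesis
    using A unfolding nowhere_dense_in_def by auto
qed

lemma dyadic_interval_inside:
  fixes a b :: real
  assumes "0 \<le> a" "a < b"
  obtains j N where "a < real j / 2 ^ N" "real (Suc j) / 2 ^ N < b"
proof -
  obtain N where N: "(1/2) ^ N < (b - a) / 2"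
    using real_arch_pow_inv[of "(b - a) / 2" "1/2"] assms by auto
  define j where "j = Suc (nat \<lfloor>a * 2 ^ N\<rfloor>)"
  have nonneg: "0 \<le> a * 2 ^ N"
    using assms by simp
  have "a * 2 ^ N < real j" "real j \<le> a * 2 ^ N + 1"
    using nonneg unfolding j_def by linarith+
  moreover have "2 < (b - a) * 2 ^ N"
    using N by (simp add: field_simps power_one_over)
  ultimately have "a * 2 ^ N < real j" "real (Suc j) < b * 2 ^ N"
    by (simp_all add: algebra_simps)
  then show ?thesis
    by (intro that[of j N]) (simp_all add: field_simps)
qed

section \<open>Residuality\<close>

text \<open>
  The events of the two lemmas below use \<open>n > m\<close> to make the time \<open>n\<close> late and, at the same time,
  positive. They are stated for subsets \<open>A\<close> of the failure sets, because the decomposition of the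
  complement needs the parts of the failure sets that lie in it.
\<close>

lemma nowhere_dense_never_short_runs:
  fixes \<phi> :: "nat \<Rightarrow> real"
  assumes d: "dyadic_digits d"
    and \<phi>: "filterlim \<phi> at_top sequentially"
    and A: "A \<subseteq> {x\<in>{0..1}. \<forall>n>m. \<not> real (run_length (d x) n) * (real m + 1) < \<phi> n}"
  shows "nowhere_dense_in (top_of_set {0..1}) A"
proof (rule nowhere_dense_in_unit_intervalI)
  show "A \<subseteq> {0..1}"
    using A by blast
next
  fix a b :: real
  assume ab: "0 \<le> a" "a < b" "b \<le> 1"
  obtain j N where jN: "a < real j / 2 ^ N" "real (Suc j) / 2 ^ N < b"
    using dyadic_interval_inside ab by metis
  have "\<forall>\<^sub>F n in sequentially. real N * (real m + 1) < \<phi> n \<and> n > m \<and> n \<ge> N"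
    using \<phi> by (intro eventually_conj eventually_gt_at_top eventually_ge_at_top)
      (auto simp: filterlim_at_top_dense)
  then obtain n where n: "real N * (real m + 1) < \<phi> n" "n > m" "n \<ge> N"
    by (auto simp: eventually_sequentially)
  define u v where "u = real j / 2 ^ N" and "v = real j / 2 ^ N + 1 / 2 ^ n"
  have "(1::real) / 2 ^ n \<le> 1 / 2 ^ N"
    using n by (intro divide_left_mono power_increasing) auto
  then have "v \<le> b"
    using jN(2) by (simp add: v_def add_divide_distrib)
  moreover have "{u<..<v} \<inter> A = {}"
  proof -
    have "x \<notin> A" if x: "u < x" "x < v" for x
    proof
      assume "x \<in> A"
      then have x01: "x \<in> {0..1}" and bad: "\<not> real (run_length (d x) n) * (real m + 1) < \<phi> n"
        using A n by auto
      have "d x k = 0" if "N < k" "k \<le> n" for k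
        using d x01 x that
        by (intro digits_zero_at_left_end[of "d x" x j N n k])
          (auto simp: dyadic_digits_def u_def v_def)
      then have "run_length (d x) n \<le> N"
        by (rule run_length_le_if_zeros)
      then have "real (run_length (d x) n) * (real m + 1) \<le> real N * (real m + 1)"
        by (intro mult_right_mono) auto
      then show False
        using bad n by linarith
    qed
    then show ?thesis
      by auto
  qed
  ultimately show "\<exists>u v. a \<le> u \<and> u < v \<and> v \<le> b \<and> {u<..<v} \<inter> A = {}"
    using jN by (intro exI[of _ u] exI[of _ v]) (auto simp: u_def v_def)
qed

lemma nowhere_dense_never_long_runs:
  fixes \<phi> :: "nat \<Rightarrow> real"
  assumes d: "dyadic_digits d"
    and pos: "\<And>n. n \<ge> 1 \<Longrightarrow> \<phi> n > 0"
    and \<phi>: "limsup (\<lambda>n. ereal (real n / \<phi> n)) = \<infinity>"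
    and A: "A \<subseteq> {x\<in>{0..1}. \<forall>n>m. \<not> real (run_length (d x) n) > real m * \<phi> n}"
  shows "nowhere_dense_in (top_of_set {0..1}) A"
proof (rule nowhere_dense_in_unit_intervalI)
  show "A \<subseteq> {0..1}"
    using A by blast
next
  fix a b :: real
  assume ab: "0 \<le> a" "a < b" "b \<le> 1"
  obtain j N where jN: "a < real j / 2 ^ N" "real (Suc j) / 2 ^ N < b"
    using dyadic_interval_inside ab by metis
  have "ereal (2 * real m) < limsup (\<lambda>n. ereal (real n / \<phi> n))"
    using \<phi> by simp
  then have "\<exists>n\<ge>max (Suc m) (2 * N). ereal (2 * real m) < ereal (real n / \<phi> n)"
    using Limsup_bounded[of "\<lambda>n. ereal (real n / \<phi> n)" "ereal (2 * real m)" sequentially]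
    unfolding eventually_sequentially by (meson linorder_not_le)
  then obtain n where n: "n > m" "n \<ge> 2 * N" "2 * real m < real n / \<phi> n"
    by (auto simp: Suc_le_eq)
  then have "2 * (real m * \<phi> n) < real n"
    using pos[of n] by (simp add: field_simps)
  moreover have "real n \<le> 2 * real (n - N)"
    using n by linarith
  ultimately have long: "real m * \<phi> n < real (n - N)"
    by linarith
  define u v where "u = real (Suc j) / 2 ^ N - 1 / 2 ^ n" and "v = real (Suc j) / 2 ^ N"
  have "(1::real) / 2 ^ n \<le> 1 / 2 ^ N"
    using n by (intro divide_left_mono power_increasing) auto
  then have "a \<le> u"
    using jN(1) by (simp add: u_def add_divide_distrib)
  moreover have "{u<..<v} \<inter> A = {}"
  proof -
    have "x \<notin> A" if x: "u < x" "x < v" for x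
    proof
      assume "x \<in> A"
      then have x01: "x \<in> {0..1}" and bad: "\<not> real (run_length (d x) n) > real m * \<phi> n"
        using A n by auto
      have "d x k = 1" if "N < k" "k \<le> n" for k
        using d x01 x that
        by (intro digits_one_at_right_end[of "d x" x j N n k])
          (auto simp: dyadic_digits_def u_def v_def)
      then have "n - N \<le> run_length (d x) n"
        using n by (intro run_length_ge_if_ones) auto
      then show False
        using bad long by linarith
    qed
    then show ?thesis
      by auto
  qed
  ultimately show "\<exists>u v. a \<le> u \<and> u < v \<and> v \<le> b \<and> {u<..<v} \<inter> A = {}"
    using jN by (intro exI[of _ u] exI[of _ v]) (auto simp: u_def v_def)
qed

lemma liminf_eq_0I:
  fixes f :: "nat \<Rightarrow> real"
  assumes nonneg: "\<And>n. n \<ge> 1 \<Longrightarrow> f n \<ge> 0"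
    and small: "\<And>m. \<exists>n>m. f n * (real m + 1) < 1"
  shows "liminf (\<lambda>n. ereal (f n)) = 0"
proof (rule antisym)
  show "0 \<le> liminf (\<lambda>n. ereal (f n))"
    using nonneg by (intro Liminf_bounded) (auto simp: eventually_sequentially)
next
  show "liminf (\<lambda>n. ereal (f n)) \<le> 0"
  proof (rule ccontr)
    assume "\<not> liminf (\<lambda>n. ereal (f n)) \<le> 0"
    then obtain c where c: "0 < ereal c" "ereal c < liminf (\<lambda>n. ereal (f n))"
      by (metis ereal_dense2 not_le zero_ereal_def)
    then obtain M where M: "\<And>n. n \<ge> M \<Longrightarrow> c < f n"
      using less_LiminfD[OF c(2)] by (auto simp: eventually_sequentially)
    obtain q where q: "inverse (real (Suc q)) < c"
      using c reals_Archimedean[of c] by auto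
    obtain n where n: "n > max M q" "f n * (real (max M q) + 1) < 1"
      using small by blast
    have "1 < c * (real q + 1)"
      using q by (simp add: field_simps)
    also have "\<dots> \<le> f n * (real (max M q) + 1)"
      using c M[of n] n by (intro mult_mono) auto
    finally show False
      using n by simp
  qed
qed

lemma limsup_eq_PInfI:
  fixes f :: "nat \<Rightarrow> real"
  assumes large: "\<And>m. \<exists>n>m. f n > real m"
  shows "limsup (\<lambda>n. ereal (f n)) = \<infinity>"
proof (rule ccontr)
  assume "limsup (\<lambda>n. ereal (f n)) \<noteq> \<infinity>"
  then obtain c where c: "limsup (\<lambda>n. ereal (f n)) < ereal c"
    by (metis ereal_dense2 ereal_infty_less(1))
  then obtain M where M: "\<And>n. n \<ge> M \<Longrightarrow> f n < c"
    using Limsup_lessD[OF c] by (auto simp: eventually_sequentially)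
  obtain q :: nat where q: "c < real q"
    using reals_Archimedean2 by blast
  obtain n where n: "n > max M q" "f n > real (max M q)"
    using large by blast
  then show False
    using M[of n] q by simp
qed

theorem theorem1p3:
  fixes \<phi> :: "nat \<Rightarrow> real" and d :: "real \<Rightarrow> nat \<Rightarrow> nat"
  assumes "dyadic_digits d"
    and "\<And>n. n \<ge> 1 \<Longrightarrow> \<phi> n > 0"
    and "mono_on {1..} \<phi>"
    and "filterlim \<phi> at_top sequentially"
    and "limsup (\<lambda>n. ereal (real n / \<phi> n)) = \<infinity>"
  shows "residual_in (top_of_set {0..1}) (E_max d \<phi>)"
proof -
  \<comment> \<open>First category asks for an exact union, so both failure sets are cut down to the complement.\<close>
  define C where "C = {0..1} - E_max d \<phi>"
  define S where "S = (\<lambda>m. {x\<in>C. \<forall>n>m. \<not> real (run_length (d x) n) * (real m + 1) < \<phi> n})"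
  define L where "L = (\<lambda>m. {x\<in>C. \<forall>n>m. \<not> real (run_length (d x) n) > real m * \<phi> n})"
  have "C \<subseteq> \<Union>(range S \<union> range L)"
  proof
    fix x assume x: "x \<in> C"
    show "x \<in> \<Union>(range S \<union> range L)"
    proof (rule ccontr)
      assume "x \<notin> \<Union>(range S \<union> range L)"
      then have short: "\<exists>n>m. real (run_length (d x) n) * (real m + 1) < \<phi> n"
        and long: "\<exists>n>m. real (run_length (d x) n) > real m * \<phi> n" for m
        using x by (auto simp: S_def L_def)
      let ?f = "\<lambda>n. real (run_length (d x) n) / \<phi> n"
      have "\<exists>n>m. ?f n * (real m + 1) < 1" for m
      proof -
        obtain n where n: "n > m" "real (run_length (d x) n) * (real m + 1) < \<phi> n"
          using short by blast
        moreover have "\<phi> n > 0"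
          using n assms(2) by simp
        ultimately show ?thesis
          by (intro exI[of _ n]) simp
      qed
      moreover have "?f n \<ge> 0" if "n \<ge> 1" for n
        using assms(2)[OF that] by simp
      ultimately have "liminf (\<lambda>n. ereal (?f n)) = 0"
        by (intro liminf_eq_0I)
      moreover have "\<exists>n>m. ?f n > real m" for m
      proof -
        obtain n where n: "n > m" "real (run_length (d x) n) > real m * \<phi> n"
          using long by blast
        moreover have "\<phi> n > 0"
          using n assms(2) by simp
        ultimately show ?thesis
          by (intro exI[of _ n]) (simp add: less_divide_eq)
      qed
      then have "limsup (\<lambda>n. ereal (?f n)) = \<infinity>"
        by (rule limsup_eq_PInfI)
      ultimately show False
        using x by (auto simp: C_def E_max_def)
    qed
  qed
  then have "C = \<Union>(range S \<union> range L)"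
    by (auto simp: S_def L_def)
  moreover have "nowhere_dense_in (top_of_set {0..1}) (S m)" for m
    by (rule nowhere_dense_never_short_runs[OF assms(1,4), of _ m]) (auto simp: S_def C_def)
  moreover have "nowhere_dense_in (top_of_set {0..1}) (L m)" for m
    by (rule nowhere_dense_never_long_runs[OF assms(1,2,5), of _ m]) (auto simp: L_def C_def)
  ultimately have "first_category_in (top_of_set {0..1}) C"
    unfolding first_category_in_def by (intro exI[of _ "range S \<union> range L"]) auto
  then show ?thesis
    unfolding residual_in_def C_def by (auto simp: E_max_def)
qed

end
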